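(* Let $k\ge 1$ be an integer and let $\varphi(x)=\psi(x+k)-\psi(k)$ for real $x\ge 0$. Let $X$ be a Poisson random variable with mean $\gamma>1$. Then $$\varphi(\gamma)\;\ge\;\mathbb E[\varphi(X)]\;\ge\;(1-e^{-1})\,\varphi(\gamma-1).$$ Specifically, $$\mathbb E[\varphi(X)]\;\ge\;\frac{\mathbb E[Y]}{\gamma+1}\,\varphi(\gamma),$$ where, with $m$ the positive integer such that $\gamma\in(m,m+1]$, $Y$ is a random variable on the nonnegative integers with distribution $$\mathbb P(Y=j)=\begin{cases}\dfrac{\gamma^j e^{-\gamma}}{j!}, & 1\le j\le m+1,\\[2mm] 0, & j\ge m+2,\\[1mm] e^{-\gamma}+\displaystyle\sum_{i=m+2}^{\infty}\frac{\gamma^i e^{-\gamma}}{i!}, & j=0.\end{cases}$$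
   Context: $\psi=\Gamma'/\Gamma$ is the logarithmic derivative of the Gamma function. *)

theory Defs
  imports "HOL-Probability.Probability"
begin

text \<open>The library constant \<^term>\<open>Digamma\<close> is defined by a series; on the positive reals it is the
  logarithmic derivative of the Gamma function.\<close>

lemma Digamma_eq_deriv_Gamma_div_Gamma:
  fixes x :: real
  assumes "x > 0"
  shows "Digamma x = deriv Gamma x / Gamma x"
proof -
  have nz: "x \<notin> \<int>\<^sub>\<le>\<^sub>0"
    using assms by (auto elim!: nonpos_Ints_cases)
  have "(Gamma has_field_derivative Gamma x * Digamma x) (at x)"
    using has_field_derivative_Gamma[OF nz] .
  then have "deriv Gamma x = Gamma x * Digamma x"
    by (rule DERIV_imp_deriv)
  moreover have "Gamma x \<noteq> 0"
    using Gamma_real_pos[OF assms] by simp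
  ultimately show ?thesis by simp
qed

definition digamma_diff :: "nat \<Rightarrow> real \<Rightarrow> real" where
  "digamma_diff k x = Digamma (x + real k) - Digamma (real k)"

definition trunc_poisson_prob :: "real \<Rightarrow> nat \<Rightarrow> nat \<Rightarrow> real" where
  "trunc_poisson_prob \<gamma> m j =
     (if j = 0 then exp (- \<gamma>) + (\<Sum>\<^sub>\<infinity>i\<in>{m + 2..}. \<gamma> ^ i * exp (- \<gamma>) / fact i)
      else if j \<le> m + 1 then \<gamma> ^ j * exp (- \<gamma>) / fact j
      else 0)"

text \<open>These weights are a probability distribution: the law of a Poisson variable whose values
  above \<open>m + 1\<close> are replaced by \<open>0\<close>.\<close>

lemma pmf_trunc_poisson:
  assumes "\<gamma> > 0"
  shows "pmf (map_pmf (\<lambda>i. if i \<le> m + 1 then i else 0) (poisson_pmf \<gamma>)) j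
           = trunc_poisson_prob \<gamma> m j"
proof -
  let ?f = "\<lambda>i::nat. if i \<le> m + 1 then i else 0"
  let ?P = "measure_pmf (poisson_pmf \<gamma>)"
  have p: "pmf (poisson_pmf \<gamma>) i = \<gamma> ^ i * exp (- \<gamma>) / fact i" for i
    using assms by simp
  have tail: "measure ?P A = (\<Sum>\<^sub>\<infinity>i\<in>A. \<gamma> ^ i * exp (- \<gamma>) / fact i)" for A
    unfolding p[symmetric] by (rule measure_pmf_conv_infsetsum[unfolded infsetsum_infsum[OF pmf_abs_summable]])
  have L: "pmf (map_pmf ?f (poisson_pmf \<gamma>)) j = measure ?P (?f -` {j})"
    by (rule pmf_map)
  consider "j = 0" | "1 \<le> j" "j \<le> m + 1" | "j \<ge> m + 2" by linarith
  then show ?thesis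
  proof cases
    case 1
    then have "?f -` {j} = {0} \<union> {m + 2..}" by (auto split: if_splits)
    then have "measure ?P (?f -` {j}) = measure ?P {0} + measure ?P {m + 2..}"
      using measure_pmf.finite_measure_Union[of "{0}" "poisson_pmf \<gamma>" "{m + 2..}"] by simp
    then show ?thesis using 1 p[of 0]
      unfolding L trunc_poisson_prob_def tail[of "{m + 2..}"] by (simp add: measure_pmf_single)
  next
    case 2
    then have "?f -` {j} = {j}" by (auto split: if_splits)
    then show ?thesis using 2 p[of j] unfolding L trunc_poisson_prob_def by (simp add: measure_pmf_single)
  next
    case 3
    then have "?f -` {j} = {}" by (auto split: if_splits)
    then show ?thesis using 3 unfolding L trunc_poisson_prob_def by simp
  qed
qed

end

theory Submission
  imports Defs
begin

text \<open>Write \<open>\<phi>\<close> for \<open>digamma_diff k\<close>, which is increasing and concave on \<open>[0, \<infinity>)\<close> with \<open>\<phi> 0 = 0\<close>. The upper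
  bound is Jensen's inequality. For the lower bounds, concavity and monotonicity give
  \<open>\<phi> n \<ge> \<phi> r / r * min n r\<close> for all natural numbers \<open>n\<close> and \<open>r \<ge> 1\<close>. Taking \<open>r = m + 1\<close> and
  discarding the values above \<open>m + 1\<close> yields the bound with \<open>Y\<close>. Taking
  \<open>r = \<lfloor>\<gamma>\<rfloor>\<close> reduces the bound with \<open>1 - 1 / e\<close> to \<open>E (min X r) \<ge> (1 - 1 / e) r\<close>: the left side
  increases with \<open>\<gamma>\<close>, and at \<open>\<gamma> = r\<close> it telescopes to \<open>r (1 - r ^ r / (e ^ r r!))\<close>.\<close>

section \<open>Monotonicity and concavity of the digamma difference\<close>

lemma digamma_diff_0 [simp]: "digamma_diff k 0 = 0"
  by (simp add: digamma_diff_def)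

lemma digamma_diff_mono:
  assumes "k \<ge> 1" "0 \<le> x" "x \<le> y"
  shows "digamma_diff k x \<le> digamma_diff k y"
  using assms by (auto simp: digamma_diff_def intro!: Digamma_real_mono)

lemma digamma_diff_nonneg:
  assumes "k \<ge> 1" "0 \<le> x"
  shows "0 \<le> digamma_diff k x"
  using digamma_diff_mono[of k 0 x] assms by simp

text \<open>The second derivative is \<open>Polygamma 2 (x + real k)\<close>, which is negative
  while the argument is positive. The open half-line has 0 in its interior for k \<ge> 1, so
  Jensen's inequality will apply even though a Poisson variable takes the value 0.\<close>

lemma digamma_diff_concave: "concave_on {- real k<..} (digamma_diff k)"
proof (rule f''_le0_imp_concave)
  fix x assume "x \<in> {- real k<..}"
  then have pos: "x + real k > 0" by simp
  then have nz: "x + real k \<notin> \<int>\<^sub>\<le>\<^sub>0" by (auto elim!: nonpos_Ints_cases)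
  show "DERIV (digamma_diff k) x :> Polygamma 1 (x + real k)"
    unfolding digamma_diff_def[abs_def] by (auto intro!: derivative_eq_intros nz)
  show "DERIV (\<lambda>x. Polygamma 1 (x + real k)) x :> Polygamma 2 (x + real k)"
    by (auto intro!: derivative_eq_intros nz simp: numeral_2_eq_2)
  show "Polygamma 2 (x + real k) \<le> 0"
    using Polygamma_real_even_neg[OF pos, of 2] by simp
qed simp

text \<open>Concavity on the segment from 0 to y, where the left endpoint contributes nothing
  because \<open>digamma_diff k 0 = 0\<close>.\<close>

lemma digamma_diff_chord:
  assumes "k \<ge> 1" "0 \<le> x" "x \<le> y" "0 < y"
  shows "x / y * digamma_diff k y \<le> digamma_diff k x"
  using concave_onD[OF digamma_diff_concave, of "x / y" 0 k y] assms by simp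

text \<open>Up to r the left side is the chord from 0; beyond r it stays at its value at r, so
  monotonicity suffices.\<close>

lemma digamma_diff_ge_min:
  assumes "k \<ge> 1" "r \<ge> 1"
  shows "digamma_diff k (real r) / real r * real (min n r) \<le> digamma_diff k (real n)"
proof (cases "n \<le> r")
  case True
  then show ?thesis
    using digamma_diff_chord[of k "real n" "real r"] assms by (simp add: min_def mult.commute)
next
  case False
  then show ?thesis
    using digamma_diff_mono[of k "real r" "real n"] assms by (simp add: min_def)
qed

section \<open>Poisson expectations\<close>

lemma poisson_has_mean:
  assumes "\<gamma> > 0"
  shows "has_bochner_integral (poisson_pmf \<gamma>) real \<gamma>"
proof -
  have "(\<lambda>n. \<gamma> * exp (- \<gamma>) * (\<gamma> ^ n /\<^sub>R fact n)) sums (\<gamma> * exp (- \<gamma>) * exp \<gamma>)"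
    by (intro sums_mult exp_converges)
  \<comment> \<open>With p the Poisson weights, (n + 1) p(n + 1) = \<gamma> p(n), so the mean is
    \<gamma> times the total mass; the index shift loses nothing because the term at 0
    vanishes.\<close>
  moreover have "\<gamma> * exp (- \<gamma>) * (\<gamma> ^ n /\<^sub>R fact n) = pmf (poisson_pmf \<gamma>) (Suc n) * real (Suc n)" for n
    using assms by (simp add: field_simps del: of_nat_Suc)
  ultimately have "(\<lambda>n. pmf (poisson_pmf \<gamma>) (Suc n) * real (Suc n)) sums \<gamma>"
    by (simp add: mult.assoc del: of_nat_Suc pmf_poisson flip: exp_add)
  then have sums: "(\<lambda>n. pmf (poisson_pmf \<gamma>) n * real n) sums \<gamma>"
    using sums_Suc_iff[of "\<lambda>n. pmf (poisson_pmf \<gamma>) n * real n"] by simp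
  have "(\<integral>\<^sup>+n. ennreal (real n) \<partial>poisson_pmf \<gamma>)
      = (\<Sum>n. ennreal (pmf (poisson_pmf \<gamma>) n * real n))"
    by (simp add: nn_integral_measure_pmf nn_integral_count_space_nat ennreal_mult del: pmf_poisson)
  also have "\<dots> = ennreal \<gamma>"
    by (rule suminf_ennreal_eq[OF _ sums]) simp
  finally show ?thesis
    using assms by (intro has_bochner_integral_nn_integral) auto
qed

text \<open>The chord inequality at x = 1 bounds the integrand by a multiple of n, whose mean is
  finite.\<close>

lemma integrable_poisson_digamma_diff:
  assumes "k \<ge> 1" "\<gamma> > 0"
  shows "integrable (poisson_pmf \<gamma>) (\<lambda>n. digamma_diff k (real n))"
proof (rule Bochner_Integration.integrable_bound)
  show "integrable (poisson_pmf \<gamma>) (\<lambda>n. digamma_diff k 1 * real n)"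
    using poisson_has_mean[OF assms(2)] by (auto simp: has_bochner_integral_iff)
  have "digamma_diff k (real n) \<le> digamma_diff k 1 * real n" for n
    using digamma_diff_chord[of k 1 "real n"] assms(1)
    by (cases "n = 0") (auto simp: field_simps)
  then show "AE n in poisson_pmf \<gamma>. norm (digamma_diff k (real n)) \<le> norm (digamma_diff k 1 * real n)"
    using digamma_diff_nonneg[OF assms(1)] by (auto simp: abs_mult)
qed simp

lemma poisson_digamma_diff_le:
  assumes "k \<ge> 1" "\<gamma> > 0"
  shows "(\<integral>n. digamma_diff k (real n) \<partial>poisson_pmf \<gamma>) \<le> digamma_diff k \<gamma>"
proof -
  have "- digamma_diff k (\<integral>n. real n \<partial>poisson_pmf \<gamma>)
      \<le> (\<integral>n. - digamma_diff k (real n) \<partial>poisson_pmf \<gamma>)"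
  proof (rule measure_pmf.jensens_inequality)
    show "AE n in poisson_pmf \<gamma>. real n \<in> {- real k<..}"
      using assms(1) by (auto intro!: AE_I2 simp: less_le_trans[of _ 0])
    show "convex_on {- real k<..} (\<lambda>x. - digamma_diff k x)"
      using digamma_diff_concave[of k] by (simp add: concave_on_def)
  qed (use poisson_has_mean[OF assms(2)] integrable_poisson_digamma_diff[OF assms]
       in \<open>auto simp: has_bochner_integral_iff\<close>)
  then show ?thesis
    using poisson_has_mean[OF assms(2)] by (simp add: has_bochner_integral_iff)
qed

section \<open>Lower bound for the capped Poisson mean\<close>

lemma poisson_cdf_has_derivative:
  "((\<lambda>x::real. \<Sum>j\<le>l. x ^ j / fact j * exp (- x)) has_real_derivative
     - (x ^ l / fact l * exp (- x))) (at x)"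
proof (induction l)
  case 0
  show ?case by (auto intro!: derivative_eq_intros)
next
  case (Suc l)
  have "((\<lambda>x::real. x ^ Suc l / fact (Suc l) * exp (- x)) has_real_derivative
      x ^ l / fact l * exp (- x) - x ^ Suc l / fact (Suc l) * exp (- x)) (at x)"
  proof -
    have "((\<lambda>x::real. x ^ Suc l / fact (Suc l)) has_real_derivative x ^ l / fact l) (at x)"
      by (rule DERIV_cdivide[THEN DERIV_cong], rule DERIV_pow)
        (simp add: fact_Suc del: of_nat_Suc)
    moreover have "((\<lambda>x::real. exp (- x)) has_real_derivative - exp (- x)) (at x)"
      by (auto intro!: derivative_eq_intros)
    ultimately show ?thesis
      by (rule DERIV_mult[THEN DERIV_cong]) simp
  qed
  \<comment> \<open>The sum telescopes: the positive term of the new derivative cancels the one left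
    by the induction hypothesis.\<close>
  from DERIV_add[OF Suc.IH this] show ?case by simp
qed

lemma poisson_cdf_antimono:
  fixes x y :: real
  assumes "0 \<le> x" "x \<le> y"
  shows "(\<Sum>j\<le>l. y ^ j / fact j * exp (- y)) \<le> (\<Sum>j\<le>l. x ^ j / fact j * exp (- x))"
proof (rule DERIV_nonpos_imp_nonincreasing[OF assms(2)])
  fix z assume "x \<le> z" "z \<le> y"
  then show "\<exists>d. DERIV (\<lambda>x. \<Sum>j\<le>l. x ^ j / fact j * exp (- x)) z :> d \<and> d \<le> 0"
    using assms(1) by (intro exI[of _ "- (z ^ l / fact l * exp (- z))"] conjI poisson_cdf_has_derivative) simp
qed

text \<open>Double counting: \<open>a j\<close> occurs in the partial sums with j \<le> l < m, which
  are m - j in number. For Poisson weights this turns an expected shortfall below m into a sum of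
  distribution functions.\<close>

lemma sum_diff_mult_eq_sum_partial_sums:
  fixes a :: "nat \<Rightarrow> real"
  shows "(\<Sum>j<m. (real m - real j) * a j) = (\<Sum>l<m. \<Sum>j\<le>l. a j)"
proof (induction m)
  case (Suc m)
  have "(\<Sum>j<Suc m. (real (Suc m) - real j) * a j) = (\<Sum>j<Suc m. (real m - real j) * a j + a j)"
    by (intro sum.cong) (auto simp: algebra_simps)
  also have "\<dots> = (\<Sum>j<m. (real m - real j) * a j) + (\<Sum>j\<le>m. a j)"
    by (simp add: sum.distrib lessThan_Suc_atMost[symmetric])
  finally show ?case using Suc.IH by simp
qed simp

text \<open>With t(j) = x^j / j!, each summand equals (j + 1) t(j + 1) - j t(j), so the sum
  telescopes.\<close>

lemma sum_diff_mult_power_div_fact: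
  fixes x :: real
  shows "(\<Sum>j<n. (x - real j) * (x ^ j / fact j)) = real n * (x ^ n / fact n)"
proof (induction n)
  case (Suc n)
  have "(\<Sum>j<Suc n. (x - real j) * (x ^ j / fact j)) = x * (x ^ n / fact n)"
    unfolding sum.lessThan_Suc Suc.IH by (simp only: distrib_right[symmetric]) simp
  also have "\<dots> = real (Suc n) * (x ^ Suc n / fact (Suc n))"
    by (simp add: fact_Suc del: of_nat_Suc)
  finally show ?case .
qed simp

text \<open>A weak form of Stirling's bound, with equality at n = 1. From n to n + 1 the left side
  grows by the factor (n + 1) (1 + 1/n)^n, the right side by (n + 1) e.\<close>

lemma power_self_le_fact_mult_exp:
  assumes "n \<ge> 1"
  shows "real n ^ n \<le> fact n * exp (real n - 1)"
  using assms
proof (induction n rule: dec_induct)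
  case (step n)
  have "(real (Suc n) / real n) ^ n = (1 + 1 / real n) ^ n"
    using step.hyps by (simp add: field_simps)
  also have "\<dots> \<le> exp (1 / real n) ^ n"
    by (intro power_mono exp_ge_add_one_self) simp
  also have "\<dots> = exp 1"
    using step.hyps by (simp flip: exp_of_nat_mult)
  finally have "real (Suc n) ^ n \<le> real n ^ n * exp 1"
    using step.hyps by (simp add: power_divide field_simps)
  also have "\<dots> \<le> fact n * exp (real n - 1) * exp 1"
    by (intro mult_right_mono step.IH) simp
  also have "\<dots> = fact n * exp (real n)"
    by (simp flip: exp_add)
  finally show ?case
    by (simp add: mult.assoc mult_left_mono)
qed simp

lemma poisson_expectation_min_ge:
  assumes "m \<ge> 1" "real m \<le> \<gamma>"
  shows "(1 - exp (- 1)) * real m \<le> (\<integral>n. real (min n m) \<partial>poisson_pmf \<gamma>)"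
proof -
  let ?p = "\<lambda>x j. x ^ j / fact j * exp (- x) :: real"
  have pos: "\<gamma> > 0" using assms by linarith
  \<comment> \<open>The shortfall m - min n m vanishes for n \<ge> m, so its expectation is a finite
    sum.\<close>
  have "(\<integral>n. real m - real (min n m) \<partial>poisson_pmf \<gamma>)
      = (\<Sum>j<m. (real m - real (min j m)) * pmf (poisson_pmf \<gamma>) j)"
    by (rule integral_measure_pmf_real) (auto simp: min_def split: if_splits)
  also have "\<dots> = (\<Sum>j<m. (real m - real j) * ?p \<gamma> j)"
    using pos by (intro sum.cong) auto
  also have "\<dots> = (\<Sum>l<m. \<Sum>j\<le>l. ?p \<gamma> j)"
    by (rule sum_diff_mult_eq_sum_partial_sums)
  \<comment> \<open>Each distribution function decreases in the mean, so the worst case is mean m;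
    there the factor m - j matches the base of the power and the sum telescopes.\<close>
  also have "\<dots> \<le> (\<Sum>l<m. \<Sum>j\<le>l. ?p (real m) j)"
    using assms(2) by (intro sum_mono poisson_cdf_antimono) auto
  also have "\<dots> = (\<Sum>j<m. (real m - real j) * ?p (real m) j)"
    by (rule sum_diff_mult_eq_sum_partial_sums[symmetric])
  also have "\<dots> = real m * (real m ^ m / fact m) * exp (- real m)"
    unfolding sum_diff_mult_power_div_fact[symmetric] sum_distrib_right
    by (simp add: mult.assoc)
  also have "\<dots> \<le> real m * exp (real m - 1) * exp (- real m)"
    using power_self_le_fact_mult_exp[OF assms(1)]
    by (intro mult_right_mono mult_left_mono) (auto simp: field_simps)
  also have "\<dots> = real m * exp (- 1)"
    by (simp add: mult.assoc flip: exp_add)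
  finally have "(\<integral>n. real m - real (min n m) \<partial>poisson_pmf \<gamma>) \<le> real m * exp (- 1)" .
  moreover have "integrable (poisson_pmf \<gamma>) (\<lambda>n. real (min n m))"
    by (rule measure_pmf.integrable_const_bound[where B = "real m"]) auto
  ultimately show ?thesis
    by (simp add: algebra_simps)
qed

section \<open>Lower bounds for the expected digamma difference\<close>

lemma poisson_digamma_diff_ge_min:
  assumes "k \<ge> 1" "\<gamma> > 0" "r \<ge> 1"
  shows "digamma_diff k (real r) / real r * (\<integral>n. real (min n r) \<partial>poisson_pmf \<gamma>)
    \<le> (\<integral>n. digamma_diff k (real n) \<partial>poisson_pmf \<gamma>)"
proof -
  have "integrable (poisson_pmf \<gamma>) (\<lambda>n. real (min n r))"
    by (rule measure_pmf.integrable_const_bound[where B = "real r"]) auto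
  then have "(\<integral>n. digamma_diff k (real r) / real r * real (min n r) \<partial>poisson_pmf \<gamma>)
    \<le> (\<integral>n. digamma_diff k (real n) \<partial>poisson_pmf \<gamma>)"
    by (intro integral_mono digamma_diff_ge_min integrable_poisson_digamma_diff assms integrable_mult_right)
  then show ?thesis by simp
qed

lemma poisson_digamma_diff_ge_shifted:
  assumes "k \<ge> 1" "\<gamma> > 1"
  shows "(1 - exp (- 1)) * digamma_diff k (\<gamma> - 1)
    \<le> (\<integral>n. digamma_diff k (real n) \<partial>poisson_pmf \<gamma>)"
proof -
  \<comment> \<open>The floor serves both sides: m \<le> \<gamma> for the capped mean, and m \<ge>
    \<gamma> - 1 for monotonicity.\<close>
  define m where "m = nat \<lfloor>\<gamma>\<rfloor>"
  have m: "m \<ge> 1" "real m \<le> \<gamma>" "\<gamma> - 1 \<le> real m"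
    using assms(2) unfolding m_def by linarith+
  have "(1 - exp (- 1)) * digamma_diff k (\<gamma> - 1) \<le> (1 - exp (- 1)) * digamma_diff k (real m)"
    using assms m by (intro mult_left_mono digamma_diff_mono) auto
  also have "\<dots> = digamma_diff k (real m) / real m * ((1 - exp (- 1)) * real m)"
    using m by simp
  also have "\<dots> \<le> digamma_diff k (real m) / real m * (\<integral>n. real (min n m) \<partial>poisson_pmf \<gamma>)"
    using assms m by (intro mult_left_mono poisson_expectation_min_ge divide_nonneg_nonneg digamma_diff_nonneg) auto
  also have "\<dots> \<le> (\<integral>n. digamma_diff k (real n) \<partial>poisson_pmf \<gamma>)"
    using assms m by (intro poisson_digamma_diff_ge_min) auto
  finally show ?thesis .
qed

text \<open>Point masses determine a measure on a countable type. This transfers expectations of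
  \<open>Y\<close> from an arbitrary probability space to an explicit law.\<close>

lemma distr_eq_measure_pmf:
  fixes Y :: "'a \<Rightarrow> 'b :: countable"
  assumes "prob_space N" "Y \<in> measurable N (count_space UNIV)"
    and "\<And>j. measure N {\<omega> \<in> space N. Y \<omega> = j} = pmf p j"
  shows "distr N (count_space UNIV) Y = measure_pmf p"
proof (rule measure_eqI_countable[where A = UNIV])
  interpret prob_space N by fact
  fix j :: 'b
  have "emeasure (distr N (count_space UNIV) Y) {j} = emeasure N {\<omega> \<in> space N. Y \<omega> = j}"
    using assms(2) by (subst emeasure_distr) (auto intro!: arg_cong[where f = "emeasure N"])
  then show "emeasure (distr N (count_space UNIV) Y) {j} = emeasure (measure_pmf p) {j}"
    using assms(3) by (simp add: emeasure_eq_measure emeasure_pmf_single)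
qed auto

lemma trunc_poisson_expectation_le:
  assumes "\<gamma> > 0" "prob_space N" "Y \<in> measurable N (count_space UNIV)"
    and "\<And>j. measure N {\<omega> \<in> space N. Y \<omega> = j} = trunc_poisson_prob \<gamma> m j"
  shows "prob_space.expectation N (\<lambda>\<omega>. real (Y \<omega>))
    \<le> (\<integral>n. real (min n (m + 1)) \<partial>poisson_pmf \<gamma>)"
proof -
  let ?g = "\<lambda>i. if i \<le> m + 1 then i else 0"
  have "distr N (count_space UNIV) Y = measure_pmf (map_pmf ?g (poisson_pmf \<gamma>))"
    using assms pmf_trunc_poisson[OF assms(1)] by (intro distr_eq_measure_pmf) auto
  then have "prob_space.expectation N (\<lambda>\<omega>. real (Y \<omega>)) = (\<integral>n. real (?g n) \<partial>poisson_pmf \<gamma>)"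
    using integral_distr[OF assms(3), of real] by simp
  \<comment> \<open>Pointwise, sending values above m + 1 to 0 gives at most what capping them at m
    + 1 gives.\<close>
  also have "\<dots> \<le> (\<integral>n. real (min n (m + 1)) \<partial>poisson_pmf \<gamma>)"
    by (intro integral_mono measure_pmf.integrable_const_bound[where B = "real (m + 1)"]) auto
  finally show ?thesis .
qed

theorem theorem6:
  fixes k :: nat and \<gamma> :: real and M :: "'a measure" and X :: "'a \<Rightarrow> nat"
  assumes "k \<ge> 1" and "\<gamma> > 1"
    and "prob_space M"
    and "X \<in> measurable M (count_space UNIV)"
    and "distr M (count_space UNIV) X = measure_pmf (poisson_pmf \<gamma>)"
  shows "digamma_diff k \<gamma> \<ge> prob_space.expectation M (\<lambda>\<omega>. digamma_diff k (real (X \<omega>)))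
    \<and> prob_space.expectation M (\<lambda>\<omega>. digamma_diff k (real (X \<omega>)))
        \<ge> (1 - exp (- 1)) * digamma_diff k (\<gamma> - 1)
    \<and> (\<forall>(m :: nat) (N :: 'b measure) (Y :: 'b \<Rightarrow> nat).
         m \<ge> 1 \<longrightarrow> \<gamma> \<in> {real m<..real m + 1} \<longrightarrow>
         prob_space N \<longrightarrow> Y \<in> measurable N (count_space UNIV) \<longrightarrow>
         (\<forall>j. measure N {\<omega> \<in> space N. Y \<omega> = j} = trunc_poisson_prob \<gamma> m j) \<longrightarrow>
         prob_space.expectation M (\<lambda>\<omega>. digamma_diff k (real (X \<omega>)))
           \<ge> prob_space.expectation N (\<lambda>\<omega>. real (Y \<omega>)) / (\<gamma> + 1) * digamma_diff k \<gamma>)"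
proof -
  have E: "prob_space.expectation M (\<lambda>\<omega>. digamma_diff k (real (X \<omega>)))
      = (\<integral>n. digamma_diff k (real n) \<partial>poisson_pmf \<gamma>)"
    using integral_distr[OF assms(4), of "\<lambda>n. digamma_diff k (real n)"] assms(5) by simp
  have "prob_space.expectation N (\<lambda>\<omega>. real (Y \<omega>)) / (\<gamma> + 1) * digamma_diff k \<gamma>
      \<le> (\<integral>n. digamma_diff k (real n) \<partial>poisson_pmf \<gamma>)"
    if m: "\<gamma> \<in> {real m<..real m + 1}" and N: "prob_space N"
      and Y: "Y \<in> measurable N (count_space UNIV)"
        "\<forall>j. measure N {\<omega> \<in> space N. Y \<omega> = j} = trunc_poisson_prob \<gamma> m j"
    for m :: nat and N :: "'b measure" and Y :: "'b \<Rightarrow> nat"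
  proof -
    let ?\<mu> = "prob_space.expectation N (\<lambda>\<omega>. real (Y \<omega>))"
    have "?\<mu> / (\<gamma> + 1) * digamma_diff k \<gamma> = ?\<mu> * (digamma_diff k \<gamma> / (\<gamma> + 1))"
      by simp
    \<comment> \<open>The two ends of m < \<gamma> \<le> m + 1 are used separately: the upper one
      raises the numerator, the lower one shrinks the denominator from \<gamma> + 1 to m +
      1.\<close>
    also have "\<dots> \<le> ?\<mu> * (digamma_diff k (real (m + 1)) / real (m + 1))"
      using assms(1,2) m
      by (intro mult_left_mono frac_le digamma_diff_mono digamma_diff_nonneg integral_nonneg) auto
    also have "\<dots> = digamma_diff k (real (m + 1)) / real (m + 1) * ?\<mu>"
      by simp
    also have "\<dots> \<le> digamma_diff k (real (m + 1)) / real (m + 1)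
        * (\<integral>n. real (min n (m + 1)) \<partial>poisson_pmf \<gamma>)"
      using assms(1,2) N Y
      by (intro mult_left_mono trunc_poisson_expectation_le divide_nonneg_nonneg digamma_diff_nonneg) auto
    also have "\<dots> \<le> (\<integral>n. digamma_diff k (real n) \<partial>poisson_pmf \<gamma>)"
      using assms(1,2) by (intro poisson_digamma_diff_ge_min) auto
    finally show ?thesis .
  qed
  with poisson_digamma_diff_le poisson_digamma_diff_ge_shifted assms(1,2) show ?thesis
    unfolding E by simp
qed

end
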